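(* Let $G$ be an infinite abelian group. Then $G\nrightarrow(\omega)^{\mathrm{FS}}_\omega$; that is, there is a colouring $c:G\to\omega$ such that there is no infinite set $X\subseteq G$ for which $c$ is constant on $\mathrm{FS}(X)$.
   Context: For a subset $X$ of an abelian group, $\mathrm{FS}(X)=\{\sum_{x\in F}x\mid F\subseteq X\text{ finite and nonempty}\}$. *)

theory Defs
  imports "HOL-Analysis.Analysis"
begin

definition FS :: "'a::ab_group_add set \<Rightarrow> 'a set" where
  "FS X = {\<Sum>x\<in>F. x | F. F \<subseteq> X \<and> finite F \<and> F \<noteq> {}}"

end

theory Submission
  imports Defs "HOL-Library.Function_Algebras"
begin

text \<open>
  Every abelian group \<open>G\<close> embeds into a direct sum of copies of the countable group
  \<open>\<rat> \<times> \<rat>/\<int>\<close>: by Zorn's lemma there is a maximal isomorphism between a subgroup of \<open>G\<close> and a subgroup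
  of the direct sum, and maximality forces it to be defined on all of \<open>G\<close>. Now colour \<open>x\<close> by the size of its
  support together with the finite set \<open>V\<close> of its coordinates. Suppose that \<open>FS X\<close> is monochromatic
  for an infinite \<open>X\<close>, and let \<open>S\<close> be the support of some \<open>x \<in> X\<close>. By pigeonhole, infinitely many
  elements of \<open>X\<close> have the same restriction \<open>v\<close> to \<open>S\<close>. All multiples of \<open>v\<close> have coordinates in \<open>V\<close>,
  so \<open>K v = 0\<close> for some \<open>K > 0\<close>, and the sum \<open>t\<close> of \<open>K\<close> such elements vanishes on \<open>S\<close>. Since \<open>x + t\<close>
  and \<open>x\<close> have supports of the same size, \<open>t = 0\<close>, so the common support size is \<open>0\<close>
  and \<open>X \<subseteq> {0}\<close>.
\<close>

section \<open>Abelian groups as modules over the integers\<close>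

text \<open>Integer multiples as a scalar action: through the \<open>module\<close> locale,
  subspaces and spans become subgroups and generated subgroups. At least one of the two sums is
  empty, since \<open>nat\<close> truncates negatives to 0.\<close>

definition zmul :: "int \<Rightarrow> 'a::ab_group_add \<Rightarrow> 'a" where
  "zmul k x = (\<Sum>i<nat k. x) - (\<Sum>i<nat (- k). x)"

lemma zmul_of_nat: "zmul (int n) x = (\<Sum>i<n. x)"
  by (simp add: zmul_def)

lemma sum_const_add: "(\<Sum>i<m + n. x) = (\<Sum>i<m. x) + (\<Sum>i<n :: nat. x :: 'a::ab_group_add)"
  by (induction n) (simp_all add: algebra_simps)

lemma zmul_diff_of_nat: "zmul (int a - int b) x = (\<Sum>i<a. x) - (\<Sum>i<b. x)"
proof (cases "b \<le> a")
  case True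
  then obtain c where "a = b + c" using le_Suc_ex by blast
  then show ?thesis using sum_const_add[of x b c] by (simp add: zmul_def)
next
  case False
  then obtain c where "b = a + c" using le_Suc_ex nat_le_linear by metis
  then show ?thesis using sum_const_add[of x a c] by (simp add: zmul_def)
qed

lemma zmul_hom:
  fixes h :: "'a::ab_group_add \<Rightarrow> 'b::ab_group_add"
  assumes "\<And>x y. h (x + y) = h x + h y"
  shows "h (zmul k x) = zmul k (h x)"
proof -
  interpret additive h using assms by unfold_locales
  show ?thesis by (simp add: zmul_def sum diff)
qed

lemma zmul_add_left: "zmul (j + k) x = zmul j x + zmul k x"
proof -
  obtain a b where j: "j = int a - int b" by (metis int_diff_cases)
  obtain c d where k: "k = int c - int d" by (metis int_diff_cases)
  have "j + k = int (a + c) - int (b + d)" using j k by simp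
  then have "zmul (j + k) x = (\<Sum>i<a + c. x) - (\<Sum>i<b + d. x)"
    by (simp only: zmul_diff_of_nat)
  then show ?thesis by (simp add: j k zmul_diff_of_nat sum_const_add)
qed

interpretation zmul: module zmul
proof
  show right: "zmul k (x + y) = zmul k x + zmul k y" for k and x y :: 'a
    by (simp add: zmul_def sum.distrib)
  show left: "zmul (j + k) x = zmul j x + zmul k x" for j k and x :: 'a
    by (rule zmul_add_left)
  show one: "zmul 1 x = x" for x :: 'a
    by (simp add: zmul_def)
  \<comment> \<open>Associativity follows from \<open>zmul_hom\<close> for the additive map
    \<open>\<lambda>k. zmul k x\<close>, once \<open>zmul\<close> on the integers is known to be
    ordinary multiplication.\<close>
  show "zmul j (zmul k x) = zmul (j * k) x" for j k and x :: 'a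
  proof -
    have h: "zmul (zmul m n) x = zmul m (zmul n x)" for m n :: int
      using zmul_hom[of "\<lambda>k. zmul k x" m n] left by blast
    have "zmul j k = j * k"
      using zmul_hom[of "\<lambda>l. l * k" j 1]
      by (simp add: distrib_right) (simp add: zmul_def)
    then show ?thesis using h by metis
  qed
qed

lemma zmul_Pair: "zmul k (x, y) = (zmul k x, zmul k y)"
  using zmul_hom[of fst k "(x, y)"] zmul_hom[of snd k "(x, y)"] by (simp add: prod_eq_iff)

lemma zmul_apply: "zmul k f i = zmul k (f i)"
  using zmul_hom[of "\<lambda>f. f i" k f] by simp

lemma zmul_rat: "zmul k (q :: rat) = of_int k * q"
  by (cases "0 \<le> k") (simp_all add: zmul_def)

section \<open>A countable divisible group with elements of every order\<close>

quotient_type rat_mod_int = rat / "\<lambda>x y. x - y \<in> \<int>"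
  morphisms rep_rat_mod_int rmi
proof (rule equivpI)
  show "reflp (\<lambda>x y :: rat. x - y \<in> \<int>)" by (simp add: reflp_def)
  show "symp (\<lambda>x y :: rat. x - y \<in> \<int>)"
    by (rule sympI) (metis Ints_minus minus_diff_eq)
  show "transp (\<lambda>x y :: rat. x - y \<in> \<int>)"
    by (rule transpI) (metis Ints_add diff_add_cancel add_diff_eq)
qed

instantiation rat_mod_int :: ab_group_add
begin
lift_definition zero_rat_mod_int :: rat_mod_int is 0 .
lift_definition plus_rat_mod_int :: "rat_mod_int \<Rightarrow> rat_mod_int \<Rightarrow> rat_mod_int" is "(+)"
  by (simp add: add_diff_add Ints_add)
lift_definition uminus_rat_mod_int :: "rat_mod_int \<Rightarrow> rat_mod_int" is uminus
  by (metis Ints_minus minus_diff_minus)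
lift_definition minus_rat_mod_int :: "rat_mod_int \<Rightarrow> rat_mod_int \<Rightarrow> rat_mod_int" is "(-)"
proof -
  fix a b c d :: rat
  assume "a - b \<in> \<int>" "c - d \<in> \<int>"
  then have "(a - b) - (c - d) \<in> \<int>" by (rule Ints_diff)
  then show "(a - c) - (b - d) \<in> \<int>" by (simp add: algebra_simps)
qed
instance by standard (transfer; simp)+
end

instance rat_mod_int :: countable
proof
  have "inj rep_rat_mod_int"
    by (metis Quotient_abs_rep Quotient_rat_mod_int injI)
  then have "inj (to_nat \<circ> rep_rat_mod_int)" by (simp add: inj_compose)
  then show "\<exists>f :: rat_mod_int \<Rightarrow> nat. inj f" by blast
qed

lemma zmul_rmi: "zmul k (rmi q) = rmi (of_int k * q)"
  using zmul_hom[of rmi k q] by (simp add: plus_rat_mod_int.abs_eq zmul_rat)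

lemma rmi_eq_0_iff: "rmi q = 0 \<longleftrightarrow> q \<in> \<int>"
  by (simp add: zero_rat_mod_int_def rat_mod_int.abs_eq_iff)

lemma zmul_divisible:
  assumes "m > 0"
  shows "\<exists>d. zmul m d = (c :: rat \<times> rat_mod_int)"
proof -
  obtain a b where c: "c = (a, rmi b)"
    by (metis Quotient_abs_rep Quotient_rat_mod_int surj_pair)
  have "zmul m (a / of_int m, rmi (b / of_int m)) = c"
    using assms by (simp add: c zmul_Pair zmul_rat zmul_rmi)
  then show ?thesis by blast
qed

text \<open>The rational factor supplies infinite order, by \<open>(1, 0)\<close>; the torsion
  factor supplies each finite order \<open>m\<close>, by the class of \<open>1/m\<close>.\<close>

lemma exists_same_order:
  fixes g :: "'a::ab_group_add"
  shows "\<exists>c :: rat \<times> rat_mod_int. \<forall>n. zmul n c = 0 \<longleftrightarrow> zmul n g = 0"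
proof (cases "\<exists>m>0. zmul (int m) g = 0")
  case False
  have "n = 0" if "zmul n g = 0" for n
  proof (rule ccontr)
    assume "n \<noteq> 0"
    moreover have "zmul \<bar>n\<bar> g = 0" using that by (simp add: abs_if)
    ultimately show False using False[simplified, rule_format, of "nat \<bar>n\<bar>"] by simp
  qed
  then have "\<forall>n. zmul n (1 :: rat, 0 :: rat_mod_int) = 0 \<longleftrightarrow> zmul n g = 0"
    by (auto simp: zmul_Pair zmul_rat zero_prod_def)
  then show ?thesis by blast
next
  case True
  define m where "m = (LEAST m. m > 0 \<and> zmul (int m) g = 0)"
  have m: "m > 0" "zmul (int m) g = 0"
    using LeastI_ex[OF True] by (auto simp: m_def)
  have "zmul n g = 0 \<longleftrightarrow> int m dvd n" for n
  proof
    assume n: "zmul n g = 0"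
    have "zmul (n mod int m) g = zmul n g - zmul (n div int m) (zmul (int m) g)"
      by (simp add: zmul.scale_left_diff_distrib[symmetric] minus_div_mult_eq_mod)
    then have "zmul (int (nat (n mod int m))) g = 0"
      using n m by simp
    moreover have "nat (n mod int m) < m" using m(1) by (simp add: nat_less_iff)
    ultimately have "nat (n mod int m) = 0"
      using not_less_Least m_def by blast
    then have "n mod int m = 0" using pos_mod_sign[of "int m" n] m(1) by linarith
    then show "int m dvd n" by auto
  next
    assume "int m dvd n"
    then obtain k where "n = k * int m" by (metis dvd_def mult.commute)
    then show "zmul n g = 0" using m(2) zmul.scale_scale[of k "int m" g] by simp
  qed
  moreover have "zmul n (0 :: rat, rmi (1 / of_nat m)) = 0 \<longleftrightarrow> int m dvd n" for n
  proof -
    have "(of_int n / of_nat m :: rat) \<in> \<int> \<longleftrightarrow> int m dvd n"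
      using of_int_div_of_int_in_Ints_iff[of n "int m", where 'a=rat] m(1) by simp
    then show ?thesis by (simp add: zmul_Pair zmul_rmi rmi_eq_0_iff zero_prod_def)
  qed
  ultimately show ?thesis by blast
qed

section \<open>Embedding into a direct sum\<close>

text \<open>Graphs of isomorphisms between a subgroup of \<open>'a\<close> and a group of finitely supported functions.
  The index set is \<open>'a\<close> itself; confining supports to the domain keeps every index outside
  the domain available for an extension.\<close>

definition partial_embedding :: "('a::ab_group_add \<times> ('a \<Rightarrow> 'c::ab_group_add)) set \<Rightarrow> bool" where
  "partial_embedding R \<longleftrightarrow> zmul.subspace R \<and>
    (\<forall>(x, y) \<in> R. (x = 0 \<longleftrightarrow> y = 0) \<and> finite {i. y i \<noteq> 0} \<and> {i. y i \<noteq> 0} \<subseteq> fst ` R)"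

lemma partial_embedding_subspace: "partial_embedding R \<Longrightarrow> zmul.subspace R"
  by (simp add: partial_embedding_def)

lemma partial_embeddingD:
  assumes "partial_embedding R" "(x, y) \<in> R"
  shows "x = 0 \<longleftrightarrow> y = 0" "finite {i. y i \<noteq> 0}" "y i \<noteq> 0 \<Longrightarrow> i \<in> fst ` R"
  using assms by (auto simp: partial_embedding_def)

text \<open>Applied to the difference of two pairs, the condition on zeros yields both
  single-valuedness and injectivity.\<close>

lemma partial_embedding_inj:
  assumes "partial_embedding R" "(x, y) \<in> R" "(x', y') \<in> R"
  shows "x = x' \<longleftrightarrow> y = y'"
  using partial_embeddingD(1)[OF assms(1), of "x - x'" "y - y'"]
    zmul.subspace_diff[OF partial_embedding_subspace[OF assms(1)] assms(2,3)]
  by simp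

lemma subspace_fst_image:
  assumes R: "zmul.subspace R"
  shows "zmul.subspace (fst ` R)"
  unfolding zmul.subspace_def
proof (intro conjI ballI allI)
  show "0 \<in> fst ` R" using zmul.subspace_0[OF R] by (metis fst_zero imageI)
  show "x + y \<in> fst ` R" if xy: "x \<in> fst ` R" "y \<in> fst ` R" for x y
  proof -
    obtain u v where "(x, u) \<in> R" "(y, v) \<in> R" using xy by auto
    then have "(x, u) + (y, v) \<in> R" by (rule zmul.subspace_add[OF R])
    then show ?thesis by force
  qed
  show "zmul k x \<in> fst ` R" if x: "x \<in> fst ` R" for k x
  proof -
    obtain y where "(x, y) \<in> R" using x by auto
    then have "zmul k (x, y) \<in> R" by (rule zmul.subspace_scale[OF R])
    then show ?thesis by (force simp: zmul_Pair)
  qed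
qed

text \<open>Each new pair is a pair of \<open>R\<close> plus a multiple of \<open>(g, d)\<close>. It
  breaks the condition on zeros only if a multiple of \<open>g\<close> and the same multiple of
  \<open>d\<close> are matched differently by \<open>R\<close>, which the second hypothesis
  excludes.\<close>

lemma partial_embedding_extend:
  assumes R: "partial_embedding R"
    and g: "\<And>x y n. (x, y) \<in> R \<Longrightarrow> zmul n g = x \<longleftrightarrow> zmul n d = y"
    and fin: "finite {i. d i \<noteq> 0}"
    and supp: "{i. d i \<noteq> 0} \<subseteq> insert g (fst ` R)"
  shows "partial_embedding (zmul.span (insert (g, d) R))"
proof -
  let ?R = "zmul.span (insert (g, d) R)"
  have sub: "zmul.subspace R" by (rule partial_embedding_subspace[OF R])
  then have spanR: "zmul.span R = R" by (simp add: zmul.span_eq_iff)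
  have base: "insert g (fst ` R) \<subseteq> fst ` ?R"
    using zmul.span_superset[of "insert (g, d) R"] by force
  have "(x = 0 \<longleftrightarrow> y = 0) \<and> finite {i. y i \<noteq> 0} \<and> {i. y i \<noteq> 0} \<subseteq> fst ` ?R"
    if "(x, y) \<in> ?R" for x y
  proof -
    obtain k where "(x, y) - zmul k (g, d) \<in> R"
      using \<open>(x, y) \<in> ?R\<close> zmul.span_breakdown_eq[of "(x, y)" "(g, d)" R] by (auto simp: spanR)
    then have k: "(x - zmul k g, y - zmul k d) \<in> R" by (simp add: zmul_Pair)
    have "(zmul k g - x, zmul k d - y) \<in> R"
      using zmul.subspace_neg[OF sub k] by simp
    from g[OF this, of k] have "x = 0 \<longleftrightarrow> y = 0"
      by (simp add: eq_diff_eq)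
    moreover have *: "{i. y i \<noteq> 0} \<subseteq> {i. (y - zmul k d) i \<noteq> 0} \<union> {i. d i \<noteq> 0}"
      by (auto simp: zmul_apply)
    have "finite {i. y i \<noteq> 0}"
      using finite_subset[OF *] partial_embeddingD(2)[OF R k] fin by blast
    moreover have "{i. (y - zmul k d) i \<noteq> 0} \<subseteq> insert g (fst ` R)"
      using partial_embeddingD(3)[OF R k] by blast
    then have "{i. y i \<noteq> 0} \<subseteq> fst ` ?R"
      by (rule subset_trans[OF subset_trans[OF * Un_least[OF _ supp]] base])
    ultimately show ?thesis by blast
  qed
  then show ?thesis by (auto simp: partial_embedding_def zmul.subspace_span)
qed

lemma subspace_Union_chain:
  assumes "C \<noteq> {}" "subset.chain A C" "\<And>R. R \<in> C \<Longrightarrow> zmul.subspace R"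
  shows "zmul.subspace (\<Union>C)"
  unfolding zmul.subspace_def
proof (intro conjI ballI allI)
  show "0 \<in> \<Union>C" using assms(1,3) zmul.subspace_0 by blast
next
  fix x y assume "x \<in> \<Union>C" "y \<in> \<Union>C"
  then obtain P Q where "P \<in> C" "x \<in> P" "Q \<in> C" "y \<in> Q" by blast
  moreover from this have "P \<subseteq> Q \<or> Q \<subseteq> P"
    using assms(2) by (auto simp: subset_chain_def)
  ultimately show "x + y \<in> \<Union>C" using assms(3) zmul.subspace_add by blast
next
  fix x k assume "x \<in> \<Union>C"
  then show "zmul k x \<in> \<Union>C" using assms(3) zmul.subspace_scale by blast
qed

lemma maximal_partial_embedding:
  obtains M :: "('a::ab_group_add \<times> ('a \<Rightarrow> 'c::ab_group_add)) set"
  where "partial_embedding M" "\<And>R. partial_embedding R \<Longrightarrow> M \<subseteq> R \<Longrightarrow> R = M"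
proof -
  let ?A = "Collect partial_embedding :: ('a \<times> ('a \<Rightarrow> 'c)) set set"
  have "partial_embedding ({0} :: ('a \<times> ('a \<Rightarrow> 'c)) set)"
    using zmul.subspace_single_0[where 'a="'a \<times> ('a \<Rightarrow> 'c)"] by (auto simp: partial_embedding_def zero_prod_def)
  then have "?A \<noteq> {}" by blast
  moreover have "\<Union>C \<in> ?A" if C: "C \<noteq> {}" "subset.chain ?A C" for C
  proof -
    have *: "partial_embedding R" if "R \<in> C" for R
      using C(2) that by (auto simp: subset_chain_def)
    have "zmul.subspace (\<Union>C)"
      using subspace_Union_chain[OF C] * partial_embedding_subspace by blast
    moreover have "(x = 0 \<longleftrightarrow> y = 0) \<and> finite {i. y i \<noteq> 0} \<and> {i. y i \<noteq> 0} \<subseteq> fst ` (\<Union>C)"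
      if xy: "(x, y) \<in> \<Union>C" for x y
    proof -
      obtain R where R: "R \<in> C" "(x, y) \<in> R" using xy by blast
      show ?thesis
        using partial_embeddingD[OF *[OF R(1)] R(2)] R(1) by blast
    qed
    ultimately show ?thesis by (auto simp: partial_embedding_def)
  qed
  ultimately show ?thesis
    using subset_Zorn_nonempty[of ?A] that by (metis mem_Collect_eq)
qed

lemma mod_notin:
  assumes D: "zmul.subspace D"
    and m: "m > 0" "zmul m g \<in> D"
  shows "zmul (n mod m) g \<in> D \<longleftrightarrow> zmul n g \<in> D"
proof -
  have eq: "zmul (n mod m) g = zmul n g - zmul (n div m) (zmul m g)"
    by (simp add: zmul.scale_left_diff_distrib[symmetric] minus_div_mult_eq_mod)
  have "zmul (n div m) (zmul m g) \<in> D"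
    using D m(2) by (rule zmul.subspace_scale)
  then show ?thesis
    using zmul.subspace_add[OF D] zmul.subspace_diff[OF D] eq
    by (metis diff_add_cancel)
qed

text \<open>Maximality is used twice. By \<open>ord\<close>, every element outside the domain
  \<open>D\<close> has a nonzero multiple in \<open>D\<close>, as it could otherwise be sent to a
  fresh coordinate. By \<open>div\<close>, an element with a multiple in \<open>D\<close> can then
  be adjoined by dividing the image of that multiple.\<close>

lemma embedding_into_direct_sum:
  assumes div: "\<And>m (c :: 'c::ab_group_add). m > 0 \<Longrightarrow> \<exists>d. zmul m d = c"
    and ord: "\<And>g :: 'a::ab_group_add. \<exists>c :: 'c::ab_group_add. \<forall>n. zmul n c = 0 \<longleftrightarrow> zmul n g = 0"
  obtains f :: "'a::ab_group_add \<Rightarrow> 'a \<Rightarrow> 'c::ab_group_add"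
  where "\<And>x y. f (x + y) = f x + f y" "inj f" "\<And>x. finite {i. f x i \<noteq> 0}"
proof -
  obtain M :: "('a \<times> ('a \<Rightarrow> 'c)) set"
    where M: "partial_embedding M" and max: "\<And>R. partial_embedding R \<Longrightarrow> M \<subseteq> R \<Longrightarrow> R = M"
    by (rule maximal_partial_embedding) blast
  have subM: "zmul.subspace M" by (rule partial_embedding_subspace[OF M])
  define D where "D = fst ` M"
  have D: "zmul.subspace D" unfolding D_def by (rule subspace_fst_image[OF subM])
  have maximal: "g \<in> D"
    if "\<And>x y n. (x, y) \<in> M \<Longrightarrow> zmul n g = x \<longleftrightarrow> zmul n d = y"
      "finite {i. d i \<noteq> 0}" "{i. d i \<noteq> 0} \<subseteq> insert g D" for g d
  proof -
    have "zmul.span (insert (g, d) M) = M"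
      using max[OF partial_embedding_extend[OF M that(1,2)]] that(3)
        zmul.span_superset[of "insert (g, d) M"] by (simp add: D_def)
    then have "(g, d) \<in> M" using zmul.span_superset[of "insert (g, d) M"] by blast
    then show ?thesis by (force simp: D_def)
  qed
  have indep: "\<exists>n. zmul n g \<in> D \<and> zmul n g \<noteq> 0" if "g \<notin> D" for g
  proof (rule ccontr)
    assume neg: "\<not> ?thesis"
    obtain c :: 'c where c: "\<And>n. zmul n c = 0 \<longleftrightarrow> zmul n g = 0" using ord by blast
    \<comment> \<open>Supports of elements in the image lie in \<open>D\<close>, so coordinate
      \<open>g\<close> is still unoccupied.\<close>
    define d where "d = (\<lambda>i. if i = g then c else 0)"
    have nd: "zmul n d = (\<lambda>i. if i = g then zmul n c else 0)" for n
      by (auto simp: d_def zmul_apply fun_eq_iff)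
    have iff: "zmul n g = x \<longleftrightarrow> zmul n d = y" if xy: "(x, y) \<in> M" for x y n
    proof
      have "x \<in> D" using xy by (force simp: D_def)
      moreover assume x: "zmul n g = x"
      ultimately have "x = 0" using neg by blast
      then have "y = 0" "zmul n c = 0"
        using partial_embeddingD(1)[OF M xy] c x by auto
      then show "zmul n d = y" by (simp add: nd fun_eq_iff)
    next
      assume y: "zmul n d = y"
      have "y g = 0" using partial_embeddingD(3)[OF M xy, of g] \<open>g \<notin> D\<close> D_def by blast
      then have "zmul n c = 0" using y nd by (metis (full_types))
      then have "zmul n g = 0" "zmul n d = 0" using c by (auto simp: nd fun_eq_iff)
      moreover from this y have "y = 0" by simp
      ultimately show "zmul n g = x" using partial_embeddingD(1)[OF M xy] by simp
    qed
    have "{i. d i \<noteq> 0} \<subseteq> {g}" by (auto simp: d_def)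
    then have "finite {i. d i \<noteq> 0}" "{i. d i \<noteq> 0} \<subseteq> insert g D"
      by (blast intro: finite_subset)+
    then have "g \<in> D" by (intro maximal[of g d] iff)
    with \<open>g \<notin> D\<close> show False ..
  qed
  have "D = UNIV"
  proof (rule ccontr)
    assume "D \<noteq> UNIV"
    then obtain g0 where g0: "g0 \<notin> D" by blast
    obtain n where n: "zmul n g0 \<in> D" "zmul n g0 \<noteq> 0" using indep[OF g0] by blast
    \<comment> \<open>The least \<open>m\<close> over all elements outside \<open>D\<close> behaves like a prime: every \<open>k\<close> that takes
      an \<open>h \<notin> D\<close> with \<open>m h \<in> D\<close> into \<open>D\<close> is a multiple of \<open>m\<close>.\<close>
    define P where "P m \<longleftrightarrow> m > 0 \<and> (\<exists>g. g \<notin> D \<and> zmul (int m) g \<in> D)" for m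
    have "zmul \<bar>n\<bar> g0 \<in> D" using n(1) zmul.subspace_neg[OF D n(1)] by (simp add: abs_if)
    moreover have "n \<noteq> 0" using n(2) by auto
    ultimately have "P (nat \<bar>n\<bar>)" using g0 by (auto simp: P_def)
    then have Pm: "P (LEAST m. P m)" by (rule LeastI)
    define m where "m = int (LEAST m. P m)"
    obtain g where g: "g \<notin> D" "zmul m g \<in> D" and m: "m > 0"
      using Pm by (auto simp: P_def m_def)
    have least: "k mod m = 0" if "zmul k h \<in> D" "zmul m h \<in> D" "h \<notin> D" for k h
    proof (rule ccontr)
      assume "k mod m \<noteq> 0"
      then have "0 < k mod m" "k mod m < m"
        using pos_mod_sign[OF m, of k] pos_mod_bound[OF m, of k] by auto
      moreover have "zmul (k mod m) h \<in> D" using mod_notin[OF D m that(2)] that(1) by simp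
      ultimately have "P (nat (k mod m))" "nat (k mod m) < (LEAST m. P m)"
        using that(3) by (auto simp: P_def m_def nat_less_iff)
      then show False using not_less_Least by blast
    qed
    obtain e where e: "(zmul m g, e) \<in> M" using g(2) by (force simp: D_def)
    \<comment> \<open>Dividing 0 by 0 keeps the support of \<open>d\<close> inside that of
      \<open>e\<close>, hence finite and inside \<open>D\<close>.\<close>
    have "\<exists>c. zmul m c = e i \<and> (e i = 0 \<longrightarrow> c = 0)" for i
      using div[OF m, of "e i"] by (cases "e i = 0") auto
    then obtain d where d: "\<And>i. zmul m (d i) = e i" "\<And>i. e i = 0 \<Longrightarrow> d i = 0" by metis
    have md: "zmul m d = e" using d(1) by (auto simp: zmul_apply fun_eq_iff)
    have mult: "(zmul (k * m) g, zmul (k * m) d) \<in> M" for k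
      using zmul.subspace_scale[OF subM e, of k] md[symmetric] by (simp add: zmul_Pair)
    have iff: "zmul n g = x \<longleftrightarrow> zmul n d = y" if xy: "(x, y) \<in> M" for x y n
    proof (cases "n mod m = 0")
      case True
      then obtain k where "n = k * m" by (metis mod_0_imp_dvd dvd_def mult.commute)
      then show ?thesis using partial_embedding_inj[OF M mult xy] by blast
    next
      case False
      have ng: "zmul n g \<notin> D" using least g False by blast
      have "x \<in> D" using xy by (force simp: D_def)
      then have "zmul n g \<noteq> x" using ng by blast
      moreover have "zmul n d \<noteq> y"
      proof
        assume y: "zmul n d = y"
        \<comment> \<open>A false match would make \<open>?t\<close> an element outside
          \<open>D\<close> killed by \<open>m\<close>. By \<open>indep\<close> some multiple
          \<open>k\<close> of it is nonzero and in \<open>D\<close>, but \<open>least\<close>,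
          applied to \<open>?t\<close> instead of \<open>g\<close>, gives that \<open>m\<close>
          divides \<open>k\<close>.\<close>
        let ?t = "zmul n g - x"
        have t: "?t \<notin> D" using ng \<open>x \<in> D\<close> zmul.subspace_add[OF D] by fastforce
        have "(zmul m x, zmul (n * m) d) \<in> M"
          using zmul.subspace_scale[OF subM xy, of m]
          by (simp add: zmul_Pair mult.commute[of n] flip: y)
        from partial_embedding_inj[OF M this mult] have "zmul m x = zmul (n * m) g"
          by simp
        then have mt: "zmul m ?t = 0"
          by (simp add: zmul.scale_right_diff_distrib mult.commute[of n])
        obtain k where k: "zmul k ?t \<in> D" "zmul k ?t \<noteq> 0" using indep[OF t] by blast
        have "k mod m = 0" using least[OF k(1) _ t] mt zmul.subspace_0[OF D] by simp
        then obtain l where "k = l * m" by (metis mod_0_imp_dvd dvd_def mult.commute)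
        then have "zmul k ?t = zmul l (zmul m ?t)" by simp
        then show False using mt k(2) by simp
      qed
      ultimately show ?thesis by blast
    qed
    have de: "{i. d i \<noteq> 0} \<subseteq> {i. e i \<noteq> 0}" using d(2) by blast
    have "{i. e i \<noteq> 0} \<subseteq> insert g D"
      using partial_embeddingD(3)[OF M e] unfolding D_def by blast
    with de have "{i. d i \<noteq> 0} \<subseteq> insert g D" by (rule subset_trans)
    moreover have "finite {i. d i \<noteq> 0}"
      using de partial_embeddingD(2)[OF M e] by (rule finite_subset)
    ultimately have "g \<in> D" by (intro maximal[of g d] iff)
    with g(1) show False ..
  qed
  then have "\<exists>y. (x, y) \<in> M" for x by (force simp: D_def)
  then obtain f where f: "\<And>x. (x, f x) \<in> M" by metis
  show ?thesis
  proof (rule that[of f])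
    show "f (x + y) = f x + f y" for x y
      using partial_embedding_inj[OF M f[of "x + y"], of "x + y" "f x + f y"]
        zmul.subspace_add[OF subM f[of x] f[of y]] by simp
    show "inj f" using partial_embedding_inj[OF M f f] by (auto simp: inj_def)
    show "finite {i. f x i \<noteq> 0}" for x by (rule partial_embeddingD(2)[OF M f])
  qed
qed

section \<open>The colouring\<close>

lemma FS_sum: "F \<subseteq> X \<Longrightarrow> finite F \<Longrightarrow> F \<noteq> {} \<Longrightarrow> \<Sum>F \<in> FS X"
  by (auto simp: FS_def)

lemma FS_bounded_support_finite_range:
  fixes f :: "'a::ab_group_add \<Rightarrow> 'i \<Rightarrow> 'c::ab_group_add"
  assumes add: "\<And>x y. f (x + y) = f x + f y"
    and inj: "inj f"
    and fin: "\<And>x. finite {i. f x i \<noteq> 0}"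
    and card: "\<And>x. x \<in> FS X \<Longrightarrow> card {i. f x i \<noteq> 0} = n"
    and V: "finite V" "\<And>x. x \<in> FS X \<Longrightarrow> range (f x) \<subseteq> V"
  shows "finite X"
proof (rule ccontr)
  assume X: "infinite X"
  have f0: "f 0 = 0" using add[of 0 0] by simp
  have f_sum: "f (\<Sum>F) i = (\<Sum>x\<in>F. f x i)" for F i
  proof -
    interpret additive "\<lambda>x. f x i" by unfold_locales (simp add: add)
    show ?thesis by (rule sum)
  qed
  obtain x0 where x0: "x0 \<in> X" using X infinite_imp_nonempty by blast
  define S where "S = {i. f x0 i \<noteq> 0}"
  \<comment> \<open>Padding with 0 outside the finite set \<open>S\<close> leaves only finitely many
    possible restrictions with values in \<open>V\<close>.\<close>
  define res where "res w = (\<lambda>i. if i \<in> S then w i else 0)" for w :: "'i \<Rightarrow> 'c"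
  have mem: "x \<in> FS X" if "x \<in> X" for x using FS_sum[of "{x}"] that by simp
  have "finite S" using fin by (simp add: S_def)
  from finite_set_of_finite_funs[OF this V(1), of 0]
  have finW: "finite {w. \<forall>i. (i \<in> S \<longrightarrow> w i \<in> V) \<and> (i \<notin> S \<longrightarrow> w i = 0)}" (is "finite ?W") .
  have "(\<lambda>x. res (f x)) ` (X - {x0}) \<subseteq> ?W"
  proof (rule image_subsetI)
    fix x assume "x \<in> X - {x0}"
    then have "f x i \<in> V" for i using V(2)[OF mem] by blast
    then show "res (f x) \<in> ?W" by (simp add: res_def)
  qed
  then have "finite ((\<lambda>x. res (f x)) ` (X - {x0}))" using finW by (rule finite_subset)
  \<comment> \<open>Removing \<open>x0\<close> first ensures that later \<open>x0 + t\<close> is a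
    sum of distinct elements of \<open>X\<close>.\<close>
  then have "\<exists>y\<in>X - {x0}. infinite {x \<in> X - {x0}. res (f x) = res (f y)}"
    using X by (intro pigeonhole_infinite) simp_all
  then obtain y Y where Y: "Y = {x \<in> X - {x0}. res (f x) = res (f y)}" "infinite Y" by blast
  have on_S: "f (\<Sum>T) i = zmul (int (card T)) (f y i)" if "T \<subseteq> Y" "i \<in> S" for T i
  proof -
    have "f x i = f y i" if "x \<in> T" for x
    proof -
      have "res (f x) = res (f y)" using \<open>T \<subseteq> Y\<close> that unfolding Y(1) by blast
      then have "res (f x) i = res (f y) i" by (rule fun_cong)
      then show ?thesis using \<open>i \<in> S\<close> by (simp add: res_def)
    qed
    then have "f (\<Sum>T) i = (\<Sum>x\<in>T. f y i)" by (simp add: f_sum)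
    also have "\<dots> = (\<Sum>k<card T. f y i)"
    proof (cases "finite T")
      case True
      then obtain h where "bij_betw h {..<card T} T"
        using ex_bij_betw_nat_finite[of T] atLeast0LessThan by auto
      then show ?thesis using sum.reindex_bij_betw[of h _ T "\<lambda>_. f y i"] by metis
    qed simp
    finally show ?thesis by (simp add: zmul_of_nat)
  qed
  \<comment> \<open>The shift \<open>Suc N\<close> keeps the sums nonempty, as \<open>FS\<close>
    requires; it cancels in \<open>K = b - a\<close>. Comparing whole functions on \<open>S\<close>
    gives one \<open>K\<close> for all coordinates at once.\<close>
  define mul where "mul N = (\<lambda>i. if i \<in> S then zmul (int (Suc N)) (f y i) else 0)" for N
  have "mul N \<in> ?W" for N
  proof -
    obtain T where T: "T \<subseteq> Y" "finite T" "card T = Suc N"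
      using infinite_arbitrarily_large[OF Y(2)] by blast
    moreover have "T \<subseteq> X" "T \<noteq> {}" using T Y(1) by auto
    ultimately have "f (\<Sum>T) i \<in> V" for i using V(2)[OF FS_sum[of T X]] by blast
    then have "zmul (int (Suc N)) (f y i) \<in> V" if "i \<in> S" for i
      using on_S[OF T(1) that] T(3) by metis
    then show ?thesis by (simp add: mul_def)
  qed
  then have "range mul \<subseteq> ?W" by blast
  then have "finite (range mul)" using finW finite_subset by blast
  then have "\<not> inj mul" using finite_imageD by blast
  then obtain a b where ab: "mul a = mul b" "a < b"
    using linorder_injI[of mul] by blast
  define K where "K = b - a"
  have K: "zmul (int K) (f y i) = 0" if "i \<in> S" for i
  proof -
    have "zmul (int (Suc a)) (f y i) = zmul (int (Suc b)) (f y i)"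
      using fun_cong[OF ab(1), of i] that by (simp add: mul_def)
    moreover have "int K = int (Suc b) - int (Suc a)" using ab(2) by (simp add: K_def)
    ultimately show ?thesis by (simp only: zmul.scale_left_diff_distrib) simp
  qed
  obtain T where T: "T \<subseteq> Y" "finite T" "card T = K"
    using infinite_arbitrarily_large[OF Y(2)] by blast
  have T': "T \<subseteq> X" "T \<noteq> {}" "x0 \<notin> T"
    using T Y(1) ab(2) by (auto simp: K_def)
  define t where "t = \<Sum>T"
  have tS: "f t i = 0" if "i \<in> S" for i
    using on_S[OF T(1) that] K[OF that] T(3) by (simp add: t_def)
  have "x0 + t \<in> FS X"
    using FS_sum[of "insert x0 T" X] T' T(2) x0 by (simp add: t_def)
  then have "card {i. f (x0 + t) i \<noteq> 0} = card S"
    using card[OF mem[OF x0]] card by (simp add: S_def)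
  \<comment> \<open>Adding \<open>t\<close> changes nothing on \<open>S\<close>; equal cardinality
    then forbids any new support outside \<open>S\<close>, so \<open>t\<close> vanishes there
    too.\<close>
  moreover have "S \<subseteq> {i. f (x0 + t) i \<noteq> 0}"
    using tS by (auto simp: add S_def)
  ultimately have "S = {i. f (x0 + t) i \<noteq> 0}"
    by (intro card_subset_eq[OF fin]) simp_all
  then have "f (x0 + t) i = 0" if "i \<notin> S" for i using that by blast
  then have "f t i = 0" if "i \<notin> S" for i
    using that by (simp add: add S_def)
  then have "f t = 0" using tS by (auto simp: fun_eq_iff)
  moreover have "t \<in> FS X" using FS_sum[OF T'(1) T(2) T'(2)] by (simp add: t_def)
  ultimately have "n = 0" using card[of t] by simp
  then have "f x = f 0" if "x \<in> X" for x
    using card[OF mem[OF that]] fin[of x] by (auto simp: f0 fun_eq_iff)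
  then have "X \<subseteq> {0}" using inj by (auto dest: injD)
  then show False using X finite_subset by blast
qed

theorem theorem5p1:
  assumes "infinite (UNIV :: 'a::ab_group_add set)"
  shows "\<exists>c :: 'a \<Rightarrow> nat. \<not> (\<exists>X :: 'a set. infinite X \<and> c constant_on (FS X))"
proof -
  obtain f :: "'a \<Rightarrow> 'a \<Rightarrow> rat \<times> rat_mod_int"
    where f: "\<And>x y. f (x + y) = f x + f y" "inj f" "\<And>x. finite {i. f x i \<noteq> 0}"
    using embedding_into_direct_sum[OF zmul_divisible exists_same_order] by blast
  have finV: "finite (range (f x))" for x
  proof (rule finite_subset)
    show "range (f x) \<subseteq> insert 0 (f x ` {i. f x i \<noteq> 0})" by auto
  qed (use f(3) in simp)
  \<comment> \<open>A list enumerating the finite set of coordinates, since lists over a countable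
    type can be coded by \<open>to_nat\<close>; the colour thus determines both the support size and
    the coordinate set.\<close>
  define vals where "vals x = (SOME vs. set vs = range (f x))" for x
  have vals: "set (vals x) = range (f x)" for x
    unfolding vals_def using finite_list[OF finV] by (rule someI_ex)
  define c where "c x = to_nat (card {i. f x i \<noteq> 0}, vals x)" for x
  have "finite X" if const: "c constant_on (FS X)" for X
  proof -
    obtain k where k: "\<And>x. x \<in> FS X \<Longrightarrow> c x = k"
      using const unfolding constant_on_def by blast
    obtain n vs where nvs: "from_nat k = (n :: nat, vs :: (rat \<times> rat_mod_int) list)" by (metis surj_pair)
    have *: "card {i. f x i \<noteq> 0} = n \<and> vals x = vs" if "x \<in> FS X" for x
      using k[OF that] nvs from_nat_to_nat unfolding c_def by (metis Pair_inject)
    show ?thesis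
      by (rule FS_bounded_support_finite_range[OF f, of X n "set vs"]) (use * vals in auto)
  qed
  then show ?thesis by blast
qed

end
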